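(* Let $(M,I,J,K,g_M)$ be a hyperkähler manifold, $(N,g_N)$ a Riemannian manifold, and $F:(M,g_M)\to(N,g_N)$ a h-Lagrangian submersion such that $(I,J,K)$ is a h-Lagrangian basis, i.e. $F$ is a Riemannian submersion with $I(\ker F_* )=(\ker F_* )^{\perp}$, $J(\ker F_* )=\ker F_*$ and $K(\ker F_* )=(\ker F_* )^{\perp}$. Then the following conditions are equivalent: a) the distribution $(\ker F_* )^{\perp}$ defines a totally geodesic foliation on $M$; b) $\mathcal{A}_X IY=0$ for all $X,Y\in\Gamma((\ker F_* )^{\perp})$; c) $\mathcal{A}_X KY=0$ for all $X,Y\in\Gamma((\ker F_* )^{\perp})$; d) $\mathcal{A}_X JY=0$ for all $X,Y\in\Gamma((\ker F_* )^{\perp})$.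
   Context: A hyperkähler manifold $(M,I,J,K,g_M)$ is a $4m$-dimensional Riemannian manifold with endomorphism fields $I,J,K$ of $TM$ satisfying $I^2=J^2=K^2=-\mathrm{id}$, $IJ=-JI=K$, $JK=-KJ=I$, $KI=-IK=J$, $g_M(RX,RY)=g_M(X,Y)$ for $R\in\{I,J,K\}$, and $\nabla I=\nabla J=\nabla K=0$, where $\nabla$ is the Levi-Civita connection of $g_M$. A Riemannian submersion $F:(M,g_M)\to(N,g_N)$ is a smooth surjective submersion such that $(F_* )_p:(\ker (F_* )_p)^{\perp}\to T_{F(p)}N$ is a linear isometry for every $p\in M$. For a vector field $U$ on $M$ write $U=\mathcal{V}U+\mathcal{H}U$ with $\mathcal{V}U\in\Gamma(\ker F_* )$ and $\mathcal{H}U\in\Gamma((\ker F_* )^{\perp})$. The O'Neill tensor $\mathcal{A}$ is $$\mathcal{A}_U W=\mathcal{H}\nabla_{\mathcal{H}U}\mathcal{V}W+\mathcal{V}\nabla_{\mathcal{H}U}\mathcal{H}W .$$ A distribution $\xi\subset TM$ defines a totally geodesic foliation if $\nabla_XY\in\Gamma(\xi)$ for all $X,Y\in\Gamma(\xi)$ (this implies integrability). *)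

theory Defs
  imports "HOL-Analysis.Analysis" "HOL-Library.Function_Algebras"
begin

instantiation "fun" :: (type, real_vector) real_vector
begin

definition scaleR_fun :: "real \<Rightarrow> ('a \<Rightarrow> 'b) \<Rightarrow> 'a \<Rightarrow> 'b"
  where "scaleR_fun c f = (\<lambda>x. c *\<^sub>R f x)"

instance
  by standard (auto simp: scaleR_fun_def fun_eq_iff scaleR_add_left scaleR_add_right)

end


section \<open>Smooth manifolds\<close>

fun Ck_on :: "nat \<Rightarrow> 'e::euclidean_space set \<Rightarrow> ('e \<Rightarrow> 'f::real_normed_vector) \<Rightarrow> bool" where
  "Ck_on 0 S f \<longleftrightarrow> continuous_on S f"
| "Ck_on (Suc k) S f \<longleftrightarrow>
     (\<forall>x\<in>S. f differentiable (at x)) \<and> (\<forall>v. Ck_on k S (\<lambda>x. frechet_derivative f (at x) v))"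

text \<open>Only used for open \<open>S\<close>.\<close>

definition smooth_on :: "'e::euclidean_space set \<Rightarrow> ('e \<Rightarrow> 'f::real_normed_vector) \<Rightarrow> bool"
  where "smooth_on S f \<longleftrightarrow> (\<forall>k. Ck_on k S f)"

text \<open>
  A chart is a pair \<open>(U, \<phi>)\<close>; the values of \<open>\<phi>\<close> outside \<open>U\<close> are irrelevant. A manifold is
  a whole Hausdorff, second countable type with an atlas, which need not be maximal: all notions
  below depend only on the smooth structure it generates. The dimension is \<open>DIM('e)\<close>.
\<close>

type_synonym ('a, 'e) atlas = "('a set \<times> ('a \<Rightarrow> 'e)) set"

definition is_chart :: "'a::topological_space set \<times> ('a \<Rightarrow> 'e::euclidean_space) \<Rightarrow> bool" where
  "is_chart = (\<lambda>(U, \<phi>). open U \<and> open (\<phi> ` U) \<and> homeomorphism U (\<phi> ` U) \<phi> (inv_into U \<phi>))"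

definition smooth_atlas ::
  "('a::{t2_space,second_countable_topology}, 'e::euclidean_space) atlas \<Rightarrow> bool" where
  "smooth_atlas A \<longleftrightarrow>
     (\<forall>c\<in>A. is_chart c) \<and> (\<Union>c\<in>A. fst c) = UNIV \<and>
     (\<forall>(U, \<phi>)\<in>A. \<forall>(V, \<psi>)\<in>A. smooth_on (\<phi> ` (U \<inter> V)) (\<psi> \<circ> inv_into U \<phi>))"

definition smooth_functions :: "('a, 'e::euclidean_space) atlas \<Rightarrow> ('a \<Rightarrow> real) set" where
  "smooth_functions A = {f. \<forall>(U, \<phi>)\<in>A. smooth_on (\<phi> ` U) (f \<circ> inv_into U \<phi>)}"

definition smooth_map ::
  "('a::topological_space, 'e::euclidean_space) atlas \<Rightarrow>
   ('b::topological_space, 'f::euclidean_space) atlas \<Rightarrow> ('a \<Rightarrow> 'b) \<Rightarrow> bool" where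
  "smooth_map A B F \<longleftrightarrow> continuous_on UNIV F \<and>
     (\<forall>(U, \<phi>)\<in>A. \<forall>(V, \<psi>)\<in>B. smooth_on (\<phi> ` (U \<inter> F -` V)) (\<psi> \<circ> F \<circ> inv_into U \<phi>))"


section \<open>Tangent vectors and vector fields\<close>

text \<open>
  Tangent vectors at \<open>p\<close> are the derivations at \<open>p\<close> of the algebra of smooth functions.
  To make equality of tangent vectors equality in HOL, they are set to \<open>0\<close> on non-smooth functions.
\<close>

type_synonym 'a tangent = "('a \<Rightarrow> real) \<Rightarrow> real"
type_synonym 'a vfield = "'a \<Rightarrow> 'a tangent"

definition tangent_space :: "('a, 'e::euclidean_space) atlas \<Rightarrow> 'a \<Rightarrow> 'a tangent set" where
  "tangent_space A p = {v.
     (\<forall>f\<in>smooth_functions A. \<forall>g\<in>smooth_functions A. v (\<lambda>x. f x + g x) = v f + v g) \<and>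
     (\<forall>f\<in>smooth_functions A. \<forall>c. v (\<lambda>x. c * f x) = c * v f) \<and>
     (\<forall>f\<in>smooth_functions A. \<forall>g\<in>smooth_functions A.
        v (\<lambda>x. f x * g x) = v f * g p + f p * v g) \<and>
     (\<forall>f. f \<notin> smooth_functions A \<longrightarrow> v f = 0)}"

definition linear_between :: "'v::real_vector set \<Rightarrow> 'w::real_vector set \<Rightarrow> ('v \<Rightarrow> 'w) \<Rightarrow> bool" where
  "linear_between V W L \<longleftrightarrow> L ` V \<subseteq> W \<and>
     (\<forall>v\<in>V. \<forall>w\<in>V. L (v + w) = L v + L w) \<and> (\<forall>v\<in>V. \<forall>c. L (c *\<^sub>R v) = c *\<^sub>R L v)"

text \<open>\<open>(F\<^sub>*)\<^sub>p\<close>; the base point is determined by the tangent vector.\<close>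

definition differential ::
  "('b, 'f::euclidean_space) atlas \<Rightarrow> ('a \<Rightarrow> 'b) \<Rightarrow> 'a tangent \<Rightarrow> 'b tangent" where
  "differential B F v = (\<lambda>h. if h \<in> smooth_functions B then v (h \<circ> F) else 0)"

definition apply_vf :: "'a vfield \<Rightarrow> ('a \<Rightarrow> real) \<Rightarrow> 'a \<Rightarrow> real" where
  "apply_vf X f = (\<lambda>p. X p f)"

definition vector_fields :: "('a, 'e::euclidean_space) atlas \<Rightarrow> 'a vfield set" where
  "vector_fields A = {X. (\<forall>p. X p \<in> tangent_space A p) \<and>
     (\<forall>f\<in>smooth_functions A. apply_vf X f \<in> smooth_functions A)}"

definition lie_bracket :: "'a vfield \<Rightarrow> 'a vfield \<Rightarrow> 'a vfield" where
  "lie_bracket X Y = (\<lambda>p f. X p (apply_vf Y f) - Y p (apply_vf X f))"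

text \<open>The space of smooth sections \<open>\<Gamma>(\<xi>)\<close> of a distribution \<open>\<xi>\<close>, given by its fibres.\<close>

definition sections ::
  "('a, 'e::euclidean_space) atlas \<Rightarrow> ('a \<Rightarrow> 'a tangent set) \<Rightarrow> 'a vfield set" where
  "sections A \<xi> = {X \<in> vector_fields A. \<forall>p. X p \<in> \<xi> p}"

type_synonym 'a endo_field = "'a \<Rightarrow> 'a tangent \<Rightarrow> 'a tangent"

definition apply_endo :: "'a endo_field \<Rightarrow> 'a vfield \<Rightarrow> 'a vfield" where
  "apply_endo R X = (\<lambda>p. R p (X p))"

definition endomorphism_field :: "('a, 'e::euclidean_space) atlas \<Rightarrow> 'a endo_field \<Rightarrow> bool" where
  "endomorphism_field A R \<longleftrightarrow>
     (\<forall>p. linear_between (tangent_space A p) (tangent_space A p) (R p)) \<and>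
     (\<forall>X\<in>vector_fields A. apply_endo R X \<in> vector_fields A)"


section \<open>Riemannian manifolds and the Levi-Civita connection\<close>

type_synonym 'a metric = "'a \<Rightarrow> 'a tangent \<Rightarrow> 'a tangent \<Rightarrow> real"

definition riemannian_manifold ::
  "('a::{t2_space,second_countable_topology}, 'e::euclidean_space) atlas \<Rightarrow> 'a metric \<Rightarrow> bool" where
  "riemannian_manifold A g \<longleftrightarrow> smooth_atlas A \<and>
     (\<forall>p. \<forall>u\<in>tangent_space A p.
        linear_between (tangent_space A p) UNIV (g p u) \<and>
        (\<forall>v\<in>tangent_space A p. g p u v = g p v u) \<and>
        (u \<noteq> 0 \<longrightarrow> g p u u > 0)) \<and>
     (\<forall>X\<in>vector_fields A. \<forall>Y\<in>vector_fields A. (\<lambda>p. g p (X p) (Y p)) \<in> smooth_functions A)"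

type_synonym 'a connection = "'a vfield \<Rightarrow> 'a vfield \<Rightarrow> 'a vfield"

definition affine_connection :: "('a, 'e::euclidean_space) atlas \<Rightarrow> 'a connection \<Rightarrow> bool" where
  "affine_connection A nabla \<longleftrightarrow>
     (\<forall>X\<in>vector_fields A. \<forall>Y\<in>vector_fields A. nabla X Y \<in> vector_fields A) \<and>
     (\<forall>X\<in>vector_fields A. \<forall>Y\<in>vector_fields A. \<forall>Z\<in>vector_fields A.
        nabla (X + Y) Z = nabla X Z + nabla Y Z \<and> nabla X (Y + Z) = nabla X Y + nabla X Z) \<and>
     (\<forall>X\<in>vector_fields A. \<forall>Y\<in>vector_fields A. \<forall>f\<in>smooth_functions A.
        nabla (\<lambda>p. f p *\<^sub>R X p) Y = (\<lambda>p. f p *\<^sub>R nabla X Y p) \<and>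
        nabla X (\<lambda>p. f p *\<^sub>R Y p) = (\<lambda>p. apply_vf X f p *\<^sub>R Y p + f p *\<^sub>R nabla X Y p))"

text \<open>
  On smooth vector fields this determines \<open>nabla\<close> uniquely; its values on other arguments are
  unspecified.
\<close>

definition levi_civita ::
  "('a, 'e::euclidean_space) atlas \<Rightarrow> 'a metric \<Rightarrow> 'a connection \<Rightarrow> bool" where
  "levi_civita A g nabla \<longleftrightarrow> affine_connection A nabla \<and>
     (\<forall>X\<in>vector_fields A. \<forall>Y\<in>vector_fields A. nabla X Y - nabla Y X = lie_bracket X Y) \<and>
     (\<forall>X\<in>vector_fields A. \<forall>Y\<in>vector_fields A. \<forall>Z\<in>vector_fields A.
        apply_vf X (\<lambda>p. g p (Y p) (Z p)) =
          (\<lambda>p. g p (nabla X Y p) (Z p) + g p (Y p) (nabla X Z p)))"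

definition parallel ::
  "('a, 'e::euclidean_space) atlas \<Rightarrow> 'a connection \<Rightarrow> 'a endo_field \<Rightarrow> bool" where
  "parallel A nabla R \<longleftrightarrow>
     (\<forall>X\<in>vector_fields A. \<forall>Y\<in>vector_fields A.
        nabla X (apply_endo R Y) - apply_endo R (nabla X Y) = 0)"

definition hyperkaehler ::
  "('a::{t2_space,second_countable_topology}, 'e::euclidean_space) atlas \<Rightarrow> 'a metric \<Rightarrow>
   'a connection \<Rightarrow> 'a endo_field \<Rightarrow> 'a endo_field \<Rightarrow> 'a endo_field \<Rightarrow> bool" where
  "hyperkaehler A g nabla I J K \<longleftrightarrow>
     (\<exists>m. DIM('e) = 4 * m) \<and> riemannian_manifold A g \<and> levi_civita A g nabla \<and>
     (\<forall>R\<in>{I, J, K}. endomorphism_field A R \<and> parallel A nabla R \<and>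
        (\<forall>p. \<forall>v\<in>tangent_space A p. R p (R p v) = - v) \<and>
        (\<forall>p. \<forall>v\<in>tangent_space A p. \<forall>w\<in>tangent_space A p. g p (R p v) (R p w) = g p v w)) \<and>
     (\<forall>p. \<forall>v\<in>tangent_space A p.
        I p (J p v) = K p v \<and> J p (I p v) = - K p v \<and>
        J p (K p v) = I p v \<and> K p (J p v) = - I p v \<and>
        K p (I p v) = J p v \<and> I p (K p v) = - J p v)"


section \<open>Riemannian submersions\<close>

definition vertical :: "('a, 'e::euclidean_space) atlas \<Rightarrow> ('b, 'f::euclidean_space) atlas \<Rightarrow>
   ('a \<Rightarrow> 'b) \<Rightarrow> 'a \<Rightarrow> 'a tangent set" where
  "vertical A B F p = {v \<in> tangent_space A p. differential B F v = 0}"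

definition horizontal :: "('a, 'e::euclidean_space) atlas \<Rightarrow> 'a metric \<Rightarrow>
   ('b, 'f::euclidean_space) atlas \<Rightarrow> ('a \<Rightarrow> 'b) \<Rightarrow> 'a \<Rightarrow> 'a tangent set" where
  "horizontal A g B F p = {v \<in> tangent_space A p. \<forall>w\<in>vertical A B F p. g p v w = 0}"

definition riemannian_submersion ::
  "('a::{t2_space,second_countable_topology}, 'e::euclidean_space) atlas \<Rightarrow> 'a metric \<Rightarrow>
   ('b::{t2_space,second_countable_topology}, 'f::euclidean_space) atlas \<Rightarrow> 'b metric \<Rightarrow>
   ('a \<Rightarrow> 'b) \<Rightarrow> bool" where
  "riemannian_submersion A g B h F \<longleftrightarrow> smooth_map A B F \<and> surj F \<and>
     (\<forall>p. differential B F ` tangent_space A p = tangent_space B (F p)) \<and>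
     (\<forall>p. linear_between (horizontal A g B F p) (tangent_space B (F p)) (differential B F) \<and>
        bij_betw (differential B F) (horizontal A g B F p) (tangent_space B (F p)) \<and>
        (\<forall>v\<in>horizontal A g B F p. \<forall>w\<in>horizontal A g B F p.
           h (F p) (differential B F v) (differential B F w) = g p v w))"

definition h_lagrangian_submersion ::
  "('a::{t2_space,second_countable_topology}, 'e::euclidean_space) atlas \<Rightarrow> 'a metric \<Rightarrow>
   ('b::{t2_space,second_countable_topology}, 'f::euclidean_space) atlas \<Rightarrow> 'b metric \<Rightarrow>
   ('a \<Rightarrow> 'b) \<Rightarrow> 'a endo_field \<Rightarrow> 'a endo_field \<Rightarrow> 'a endo_field \<Rightarrow> bool" where
  "h_lagrangian_submersion A g B h F I J K \<longleftrightarrow> riemannian_submersion A g B h F \<and>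
     (\<forall>p. I p ` vertical A B F p = horizontal A g B F p \<and>
          J p ` vertical A B F p = vertical A B F p \<and>
          K p ` vertical A B F p = horizontal A g B F p)"

text \<open>The components of \<open>U = \<V>U + \<H>U\<close>.\<close>

definition vpart :: "('a, 'e::euclidean_space) atlas \<Rightarrow> 'a metric \<Rightarrow>
   ('b, 'f::euclidean_space) atlas \<Rightarrow> ('a \<Rightarrow> 'b) \<Rightarrow> 'a vfield \<Rightarrow> 'a vfield" where
  "vpart A g B F U =
     (\<lambda>p. THE v. v \<in> vertical A B F p \<and> U p - v \<in> horizontal A g B F p)"

definition hpart :: "('a, 'e::euclidean_space) atlas \<Rightarrow> 'a metric \<Rightarrow>
   ('b, 'f::euclidean_space) atlas \<Rightarrow> ('a \<Rightarrow> 'b) \<Rightarrow> 'a vfield \<Rightarrow> 'a vfield" where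
  "hpart A g B F U = U - vpart A g B F U"

definition oneill_A :: "('a, 'e::euclidean_space) atlas \<Rightarrow> 'a metric \<Rightarrow> 'a connection \<Rightarrow>
   ('b, 'f::euclidean_space) atlas \<Rightarrow> ('a \<Rightarrow> 'b) \<Rightarrow> 'a vfield \<Rightarrow> 'a vfield \<Rightarrow> 'a vfield" where
  "oneill_A A g nabla B F U W =
     hpart A g B F (nabla (hpart A g B F U) (vpart A g B F W)) +
     vpart A g B F (nabla (hpart A g B F U) (hpart A g B F W))"

definition totally_geodesic_foliation ::
  "('a, 'e::euclidean_space) atlas \<Rightarrow> 'a connection \<Rightarrow> ('a \<Rightarrow> 'a tangent set) \<Rightarrow> bool" where
  "totally_geodesic_foliation A nabla \<xi> \<longleftrightarrow>
     (\<forall>X\<in>sections A \<xi>. \<forall>Y\<in>sections A \<xi>. nabla X Y \<in> sections A \<xi>)"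

end

theory Submission
  imports Defs
begin

text \<open>
  The structures \<open>I\<close> and \<open>K\<close> exchange the vertical and the horizontal distribution, while \<open>J\<close>,
  being an isometry, preserves both. As all three are parallel, for horizontal \<open>X\<close>, \<open>Y\<close> the field
  \<open>\<A>\<^sub>X RY\<close> is the horizontal part of \<open>R (\<nabla>\<^sub>X Y)\<close> if \<open>R\<close> is \<open>I\<close> or \<open>K\<close>, and its vertical part if
  \<open>R\<close> is \<open>J\<close>. In each case it vanishes if and only if \<open>\<nabla>\<^sub>X Y\<close> is horizontal.
\<close>

section \<open>Zero functions, zero fields and differences of tangent vectors\<close>

lemma Ck_on_const: "Ck_on k S (\<lambda>x. c)"
  by (induction k arbitrary: c) simp_all

lemma zero_in_smooth_functions: "(\<lambda>x. 0) \<in> smooth_functions A"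
  by (auto simp: smooth_functions_def smooth_on_def comp_def Ck_on_const)

lemma tangent_space_zero: "0 \<in> tangent_space A p"
  by (simp add: tangent_space_def)

lemma tangent_space_diff:
  "u \<in> tangent_space A p \<Longrightarrow> v \<in> tangent_space A p \<Longrightarrow> u - v \<in> tangent_space A p"
  by (simp add: tangent_space_def algebra_simps)

lemma vector_fields_zero: "0 \<in> vector_fields A"
  by (simp add: vector_fields_def tangent_space_zero apply_vf_def zero_in_smooth_functions)

text \<open>Additivity in the second argument at \<open>0 + 0\<close>. It removes the summand of the
  O'Neill tensor that differentiates a zero component.\<close>

lemma affine_connection_zero_right:
  assumes "affine_connection A nabla" "X \<in> vector_fields A"
  shows "nabla X 0 = 0"
proof -
  have "nabla X (0 + 0) = nabla X 0 + nabla X 0"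
    using assms vector_fields_zero unfolding affine_connection_def by blast
  then show ?thesis
    by simp
qed

lemma differential_diff: "differential B F (u - v) = differential B F u - differential B F v"
  by (auto simp: differential_def fun_eq_iff)

text \<open>The definition of a metric gives linearity in the second argument; symmetry carries it
  over to the first. Writing \<open>u\<close> as \<open>(u - v) + v\<close> reduces the difference
  to additivity.\<close>

lemma riemannian_metric_diff_left:
  assumes "riemannian_manifold A g"
    and "u \<in> tangent_space A p" "v \<in> tangent_space A p" "w \<in> tangent_space A p"
  shows "g p (u - v) w = g p u w - g p v w"
proof -
  have d: "u - v \<in> tangent_space A p"
    using assms(2,3) by (rule tangent_space_diff)
  have "linear_between (tangent_space A p) UNIV (g p w)"
    using assms(1,4) by (simp add: riemannian_manifold_def)
  then have "g p w (u - v + v) = g p w (u - v) + g p w v"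
    using assms(3) d unfolding linear_between_def by blast
  moreover have "g p x w = g p w x" if "x \<in> tangent_space A p" for x
    using assms(1,4) that by (simp add: riemannian_manifold_def)
  ultimately show ?thesis
    using assms(2,3) d by simp
qed

locale riemannian_submersion_setting =
  fixes A :: "('a::{t2_space,second_countable_topology}, 'e::euclidean_space) atlas"
    and B :: "('b::{t2_space,second_countable_topology}, 'f::euclidean_space) atlas"
    and g :: "'a metric" and h :: "'b metric"
    and F :: "'a \<Rightarrow> 'b"
  assumes manifold: "riemannian_manifold A g"
    and submersion: "riemannian_submersion A g B h F"
begin

section \<open>Vertical and horizontal spaces\<close>

abbreviation "T \<equiv> tangent_space A"
abbreviation "V \<equiv> vertical A B F"
abbreviation "H \<equiv> horizontal A g B F"

lemma vertical_tangent: "v \<in> V p \<Longrightarrow> v \<in> T p"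
  by (simp add: vertical_def)

lemma horizontal_tangent: "v \<in> H p \<Longrightarrow> v \<in> T p"
  by (simp add: horizontal_def)

lemma vertical_zero: "0 \<in> V p"
  by (simp add: vertical_def tangent_space_zero) (simp add: differential_def fun_eq_iff)

lemma vertical_diff: "u \<in> V p \<Longrightarrow> v \<in> V p \<Longrightarrow> u - v \<in> V p"
  by (simp add: vertical_def tangent_space_diff differential_diff)

lemma vertical_minus: "u \<in> V p \<Longrightarrow> - u \<in> V p"
  using vertical_diff[OF vertical_zero, of u] by simp

lemma horizontal_diff: "u \<in> H p \<Longrightarrow> v \<in> H p \<Longrightarrow> u - v \<in> H p"
  using riemannian_metric_diff_left[OF manifold]
  by (simp add: horizontal_def tangent_space_diff vertical_tangent)

lemma horizontal_zero: "0 \<in> H p"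
  using riemannian_metric_diff_left[OF manifold, of 0 p 0]
  by (simp add: horizontal_def tangent_space_zero vertical_tangent)

lemma horizontal_minus: "u \<in> H p \<Longrightarrow> - u \<in> H p"
  using horizontal_diff[OF horizontal_zero, of u] by simp

lemma vertical_horizontal_zero:
  assumes "v \<in> V p" "v \<in> H p"
  shows "v = 0"
proof (rule ccontr)
  assume "v \<noteq> 0"
  then have "g p v v > 0"
    using manifold vertical_tangent[OF assms(1)] by (simp add: riemannian_manifold_def)
  moreover have "g p v v = 0"
    using assms by (simp add: horizontal_def)
  ultimately show False
    by simp
qed

section \<open>The pointwise decomposition into vertical and horizontal parts\<close>

lemma vpart_eqI:
  assumes "v \<in> V p" "U p - v \<in> H p"
  shows "vpart A g B F U p = v"
  unfolding vpart_def
proof (rule the_equality)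
  fix w assume w: "w \<in> V p \<and> U p - w \<in> H p"
  \<comment> \<open>Two candidates for the vertical part differ by a vector that is both vertical
    and horizontal, hence zero; this makes the definite description in \<open>vpart\<close> well
    defined.\<close>
  have "(U p - v) - (U p - w) \<in> H p"
    using assms w horizontal_diff by blast
  then have "w - v \<in> H p"
    by simp
  moreover have "w - v \<in> V p"
    using assms w vertical_diff by blast
  ultimately show "w = v"
    using vertical_horizontal_zero by fastforce
qed (use assms in simp)

text \<open>The horizontal component of \<open>U p\<close> is the horizontal lift of its image under
  the differential: the lift \<open>x\<close> has the same image as \<open>U p\<close>, so
  \<open>U p - x\<close> lies in the kernel.\<close>

lemma vpart_exists:
  assumes "U p \<in> T p"
  obtains v where "v \<in> V p" "U p - v \<in> H p" "vpart A g B F U p = v"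
proof -
  have "differential B F ` T p = tangent_space B (F p)"
    and "bij_betw (differential B F) (H p) (tangent_space B (F p))"
    using submersion by (simp_all add: riemannian_submersion_def)
  then have "differential B F (U p) \<in> differential B F ` H p"
    using assms by (auto simp: bij_betw_def)
  then obtain x where x: "x \<in> H p" "differential B F x = differential B F (U p)"
    by (metis imageE)
  have "U p - x \<in> V p"
    using x assms by (simp add: vertical_def horizontal_def tangent_space_diff differential_diff)
  moreover have "U p - (U p - x) \<in> H p"
    using x by simp
  ultimately show thesis
    using that vpart_eqI by blast
qed

lemma vpart_eq_zero_iff:
  assumes "U p \<in> T p"
  shows "vpart A g B F U p = 0 \<longleftrightarrow> U p \<in> H p"
proof
  obtain v where "U p - v \<in> H p" "vpart A g B F U p = v"
    using assms by (rule vpart_exists)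
  then show "U p \<in> H p" if "vpart A g B F U p = 0"
    using that by simp
qed (simp add: vpart_eqI vertical_zero)

lemma hpart_eq_zero_iff:
  assumes "U p \<in> T p"
  shows "hpart A g B F U p = 0 \<longleftrightarrow> U p \<in> V p"
proof
  obtain v where "v \<in> V p" "vpart A g B F U p = v"
    using assms by (rule vpart_exists)
  then show "U p \<in> V p" if "hpart A g B F U p = 0"
    using that by (simp add: hpart_def)
next
  assume "U p \<in> V p"
  then have "vpart A g B F U p = U p"
    by (simp add: vpart_eqI horizontal_zero)
  then show "hpart A g B F U p = 0"
    by (simp add: hpart_def)
qed

lemma vpart_horizontal_section: "X \<in> sections A H \<Longrightarrow> vpart A g B F X = 0"
  by (rule ext) (simp add: sections_def vpart_eq_zero_iff horizontal_tangent)

lemma hpart_horizontal_section: "X \<in> sections A H \<Longrightarrow> hpart A g B F X = X"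
  by (simp add: hpart_def vpart_horizontal_section)

lemma hpart_vertical_section: "W \<in> sections A V \<Longrightarrow> hpart A g B F W = 0"
  by (rule ext) (simp add: sections_def hpart_eq_zero_iff vertical_tangent)

lemma vpart_vertical_section: "W \<in> sections A V \<Longrightarrow> vpart A g B F W = W"
  using hpart_vertical_section[of W] by (simp add: hpart_def)

lemma zero_horizontal_section: "0 \<in> sections A H"
  by (simp add: sections_def vector_fields_zero horizontal_zero)

lemma zero_vertical_section: "0 \<in> sections A V"
  by (simp add: sections_def vector_fields_zero vertical_zero)

section \<open>The O'Neill tensor on vertical and horizontal sections\<close>

lemma oneill_A_vertical:
  assumes "affine_connection A nabla" "X \<in> sections A H" "W \<in> sections A V"
  shows "oneill_A A g nabla B F X W = hpart A g B F (nabla X W)"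
proof -
  \<comment> \<open>The horizontal part of \<open>W\<close> is \<open>0\<close>, so the second
    summand of the tensor is the vertical part of \<open>nabla X 0\<close>. It vanishes because the
    zero field is also a horizontal section.\<close>
  have "nabla X 0 = 0"
    using affine_connection_zero_right assms by (auto simp: sections_def)
  then show ?thesis
    using assms zero_horizontal_section
    by (simp add: oneill_A_def hpart_horizontal_section hpart_vertical_section
        vpart_vertical_section vpart_horizontal_section)
qed

lemma oneill_A_horizontal:
  assumes "affine_connection A nabla" "X \<in> sections A H" "Y \<in> sections A H"
  shows "oneill_A A g nabla B F X Y = vpart A g B F (nabla X Y)"
proof -
  \<comment> \<open>Here the vertical part of \<open>Y\<close> is \<open>0\<close>, and the first
    summand vanishes because the zero field is also a vertical section.\<close>
  have "nabla X 0 = 0"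
    using affine_connection_zero_right assms by (auto simp: sections_def)
  then show ?thesis
    using assms zero_vertical_section
    by (simp add: oneill_A_def hpart_horizontal_section hpart_vertical_section
        vpart_horizontal_section)
qed

section \<open>Almost complex structures that swap or preserve the distributions\<close>

lemma swap_vertical_iff:
  assumes "R p ` V p = H p" and square: "\<And>v. v \<in> T p \<Longrightarrow> R p (R p v) = - v"
    and t: "t \<in> T p"
  shows "R p t \<in> V p \<longleftrightarrow> t \<in> H p"
proof
  assume "R p t \<in> V p"
  then have "R p (R p t) \<in> H p"
    using assms(1) by blast
  then show "t \<in> H p"
    using square[OF t] horizontal_minus by fastforce
next
  assume "t \<in> H p"
  \<comment> \<open>With \<open>t = R p v\<close>, the square condition gives
    \<open>R p t = - v\<close>, which is vertical.\<close>
  then obtain v where "v \<in> V p" "t = R p v"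
    using assms(1) by blast
  then show "R p t \<in> V p"
    using square vertical_tangent vertical_minus by simp
qed

text \<open>An isometry mapping the vertical space onto itself also maps its orthogonal complement
  into itself. The converse applies this to \<open>R p t\<close>, since applying \<open>R p\<close>
  once more returns \<open>- t\<close>.\<close>

lemma preserve_horizontal_iff:
  assumes "R p ` V p = V p" and square: "\<And>v. v \<in> T p \<Longrightarrow> R p (R p v) = - v"
    and "\<And>v. v \<in> T p \<Longrightarrow> R p v \<in> T p"
    and "\<And>v w. v \<in> T p \<Longrightarrow> w \<in> T p \<Longrightarrow> g p (R p v) (R p w) = g p v w"
    and t: "t \<in> T p"
  shows "R p t \<in> H p \<longleftrightarrow> t \<in> H p"
proof -
  have preserve: "R p x \<in> H p" if x: "x \<in> H p" for x
  proof -
    have "g p (R p x) w = 0" if "w \<in> V p" for w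
    proof -
      have "w \<in> R p ` V p"
        using assms(1) that by simp
      then obtain u where u: "u \<in> V p" "w = R p u"
        by blast
      then have "g p (R p x) w = g p x u"
        using assms(4) horizontal_tangent[OF x] vertical_tangent by simp
      then show ?thesis
        using x u by (simp add: horizontal_def)
    qed
    then show ?thesis
      using assms(3) horizontal_tangent[OF x] by (simp add: horizontal_def)
  qed
  have "- (- t) \<in> H p" if "R p t \<in> H p"
    using horizontal_minus[OF preserve[OF that]] square[OF t] by simp
  then show ?thesis
    using preserve by auto
qed

text \<open>This serves \<open>I\<close> and \<open>K\<close>. Since \<open>R\<close> is parallel it
  moves out of the covariant derivative, and then \<open>swap_vertical_iff\<close> decides at each
  point whether the horizontal part vanishes.\<close>

lemma oneill_A_swap_eq_zero_iff:
  assumes connection: "affine_connection A nabla"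
    and R: "endomorphism_field A R" "parallel A nabla R"
    and square: "\<And>p v. v \<in> T p \<Longrightarrow> R p (R p v) = - v"
    and swap: "\<And>p. R p ` V p = H p"
    and X: "X \<in> sections A H" and Y: "Y \<in> sections A H"
  shows "oneill_A A g nabla B F X (apply_endo R Y) = 0 \<longleftrightarrow> nabla X Y \<in> sections A H"
proof -
  have XY: "X \<in> vector_fields A" "Y \<in> vector_fields A"
    using X Y by (simp_all add: sections_def)
  then have nabla: "nabla X Y \<in> vector_fields A"
    using connection unfolding affine_connection_def by blast
  then have tangent: "nabla X Y p \<in> T p" for p
    by (simp add: vector_fields_def)
  have R_tangent: "R p v \<in> T p" if "v \<in> T p" for p v
    using R(1) that unfolding endomorphism_field_def linear_between_def by blast
  have "apply_endo R Y \<in> sections A V"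
    using R(1) XY Y swap_vertical_iff[of R, OF swap square] horizontal_tangent
    by (simp add: sections_def endomorphism_field_def apply_endo_def)
  moreover have "nabla X (apply_endo R Y) = apply_endo R (nabla X Y)"
    using R(2) XY by (simp add: parallel_def)
  ultimately have "oneill_A A g nabla B F X (apply_endo R Y) =
      hpart A g B F (apply_endo R (nabla X Y))"
    using oneill_A_vertical[OF connection X] by simp
  then have "oneill_A A g nabla B F X (apply_endo R Y) = 0 \<longleftrightarrow> (\<forall>p. R p (nabla X Y p) \<in> V p)"
    using tangent R_tangent
    \<comment> \<open>Extensionality is restricted to fields: tangent vectors are functions too, and
      must stay whole for the pointwise criterion to match.\<close>
    by (simp add: fun_eq_iff[of _ "0::'a vfield"] hpart_eq_zero_iff apply_endo_def)
  also have "\<dots> \<longleftrightarrow> nabla X Y \<in> sections A H"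
    using swap_vertical_iff[of R, OF swap square] tangent nabla by (simp add: sections_def)
  finally show ?thesis .
qed

text \<open>The counterpart for \<open>J\<close>: now \<open>apply_endo R Y\<close> stays
  horizontal, so the vertical part survives, and the isometry property enters through
  \<open>preserve_horizontal_iff\<close>.\<close>

lemma oneill_A_preserve_eq_zero_iff:
  assumes connection: "affine_connection A nabla"
    and R: "endomorphism_field A R" "parallel A nabla R"
    and square: "\<And>p v. v \<in> T p \<Longrightarrow> R p (R p v) = - v"
    and isometry: "\<And>p v w. v \<in> T p \<Longrightarrow> w \<in> T p \<Longrightarrow> g p (R p v) (R p w) = g p v w"
    and preserve: "\<And>p. R p ` V p = V p"
    and X: "X \<in> sections A H" and Y: "Y \<in> sections A H"
  shows "oneill_A A g nabla B F X (apply_endo R Y) = 0 \<longleftrightarrow> nabla X Y \<in> sections A H"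
proof -
  have XY: "X \<in> vector_fields A" "Y \<in> vector_fields A"
    using X Y by (simp_all add: sections_def)
  then have nabla: "nabla X Y \<in> vector_fields A"
    using connection unfolding affine_connection_def by blast
  then have tangent: "nabla X Y p \<in> T p" for p
    by (simp add: vector_fields_def)
  have R_tangent: "R p v \<in> T p" if "v \<in> T p" for p v
    using R(1) that unfolding endomorphism_field_def linear_between_def by blast
  note horizontal_iff = preserve_horizontal_iff[of R, OF preserve square R_tangent isometry]
  have "apply_endo R Y \<in> sections A H"
    using R(1) XY Y horizontal_iff horizontal_tangent
    by (simp add: sections_def endomorphism_field_def apply_endo_def)
  moreover have "nabla X (apply_endo R Y) = apply_endo R (nabla X Y)"
    using R(2) XY by (simp add: parallel_def)
  ultimately have "oneill_A A g nabla B F X (apply_endo R Y) =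
      vpart A g B F (apply_endo R (nabla X Y))"
    using oneill_A_horizontal[OF connection X] by simp
  then have "oneill_A A g nabla B F X (apply_endo R Y) = 0 \<longleftrightarrow> (\<forall>p. R p (nabla X Y p) \<in> H p)"
    using tangent R_tangent
    by (simp add: fun_eq_iff[of _ "0::'a vfield"] vpart_eq_zero_iff apply_endo_def)
  also have "\<dots> \<longleftrightarrow> nabla X Y \<in> sections A H"
    using horizontal_iff tangent nabla by (simp add: sections_def)
  finally show ?thesis .
qed

end

text \<open>Each of b), c) and d) is compared with a), which makes all four conditions
  equivalent.\<close>

theorem lemma3p12:
  fixes A :: "('a::{t2_space,second_countable_topology}, 'e::euclidean_space) atlas"
    and B :: "('b::{t2_space,second_countable_topology}, 'f::euclidean_space) atlas"
    and g :: "'a metric" and h :: "'b metric"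
    and nabla :: "'a connection"
    and I J K :: "'a endo_field"
    and F :: "'a \<Rightarrow> 'b"
  assumes "hyperkaehler A g nabla I J K"
    and "riemannian_manifold B h"
    and "h_lagrangian_submersion A g B h F I J K"
  defines "\<Gamma>H \<equiv> sections A (horizontal A g B F)"
    and "\<A> \<equiv> oneill_A A g nabla B F"
  shows "(totally_geodesic_foliation A nabla (horizontal A g B F) \<longleftrightarrow>
            (\<forall>X\<in>\<Gamma>H. \<forall>Y\<in>\<Gamma>H. \<A> X (apply_endo I Y) = 0)) \<and>
         (totally_geodesic_foliation A nabla (horizontal A g B F) \<longleftrightarrow>
            (\<forall>X\<in>\<Gamma>H. \<forall>Y\<in>\<Gamma>H. \<A> X (apply_endo K Y) = 0)) \<and>
         (totally_geodesic_foliation A nabla (horizontal A g B F) \<longleftrightarrow>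
            (\<forall>X\<in>\<Gamma>H. \<forall>Y\<in>\<Gamma>H. \<A> X (apply_endo J Y) = 0))"
proof -
  have hk: "riemannian_manifold A g" "affine_connection A nabla"
    using assms(1) by (simp_all add: hyperkaehler_def levi_civita_def)
  have R: "endomorphism_field A R" "parallel A nabla R"
    "\<And>p v. v \<in> tangent_space A p \<Longrightarrow> R p (R p v) = - v"
    "\<And>p v w. v \<in> tangent_space A p \<Longrightarrow> w \<in> tangent_space A p \<Longrightarrow> g p (R p v) (R p w) = g p v w"
    if "R \<in> {I, J, K}" for R
    using assms(1) that unfolding hyperkaehler_def by blast+
  have sub: "riemannian_submersion A g B h F"
    "\<And>p. I p ` vertical A B F p = horizontal A g B F p"
    "\<And>p. J p ` vertical A B F p = vertical A B F p"
    "\<And>p. K p ` vertical A B F p = horizontal A g B F p"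
    using assms(3) by (simp_all add: h_lagrangian_submersion_def)
  interpret riemannian_submersion_setting A B g h F
    using hk(1) sub(1) by unfold_locales
  \<comment> \<open>The equivalence holds for each pair \<open>X\<close>, \<open>Y\<close>
    separately, with a right-hand side independent of \<open>R\<close>; quantifying over both fields
    yields all three claims.\<close>
  have iff: "\<A> X (apply_endo R Y) = 0 \<longleftrightarrow> nabla X Y \<in> \<Gamma>H"
    if "R \<in> {I, J, K}" "X \<in> \<Gamma>H" "Y \<in> \<Gamma>H" for R X Y
  proof (cases "R = J")
    case True
    then show ?thesis
      using oneill_A_preserve_eq_zero_iff[OF hk(2) R[OF that(1)]] sub(3) that(2,3)
      unfolding \<Gamma>H_def \<A>_def by blast
  next
    case False
    then have "R = I \<or> R = K"
      using that(1) by simp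
    then have "R p ` vertical A B F p = horizontal A g B F p" for p
      by (elim disjE) (simp_all only: sub)
    then show ?thesis
      using oneill_A_swap_eq_zero_iff[OF hk(2) R(1-3)[OF that(1)]] that(2,3)
      unfolding \<Gamma>H_def \<A>_def by blast
  qed
  then show ?thesis
    unfolding totally_geodesic_foliation_def \<Gamma>H_def[symmetric] by simp
qed

end
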